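(* Let $M$ be a connected matroid, let $N$ be a binary matroid, and let $f: M \rightarrow N$ be a matroid homomorphism. Then either, for every $x \in E(N)$, the set $f^{-1}(x)$ is a series class of $M$, or $N$ is a circuit (that is, $E(N) \in \mathcal{C}(N)$).
   Context: For a matroid $X$, $E(X)$ denotes its ground set and $\mathcal{C}(X)$ its set of circuits. A matroid homomorphism $f: M \rightarrow N$ is a map $f: E(M) \rightarrow E(N)$ from the ground set of $M$ onto the ground set of $N$ such that $f(C) \in \mathcal{C}(N)$ for every $C \in \mathcal{C}(M)$. A set $S \subseteq E(M)$ is called a series class of $M$ if its elements are pairwise in series, i.e., every circuit of $M$ that meets $S$ contains $S$ (equivalently, there are no $x_1, x_2 \in S$ and $A \in \mathcal{C}(M)$ with $x_1 \in A$, $x_2 \notin A$). *)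

theory Defs
  imports Main "HOL-Library.Z2"
begin

record 'a matroid =
  ground :: "'a set"
  indep :: "'a set set"

locale matroid =
  fixes M :: "'a matroid"
  assumes finite_ground: "finite (ground M)"
    and indep_subset_ground: "X \<in> indep M \<Longrightarrow> X \<subseteq> ground M"
    and indep_empty: "{} \<in> indep M"
    and indep_subset: "X \<in> indep M \<Longrightarrow> Y \<subseteq> X \<Longrightarrow> Y \<in> indep M"
    and indep_augment:
      "X \<in> indep M \<Longrightarrow> Y \<in> indep M \<Longrightarrow> card X < card Y \<Longrightarrow>
        \<exists>y \<in> Y - X. insert y X \<in> indep M"

definition circuits :: "'a matroid \<Rightarrow> 'a set set" where
  "circuits M = {C. C \<subseteq> ground M \<and> C \<notin> indep M \<and> (\<forall>D. D \<subset> C \<longrightarrow> D \<in> indep M)}"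

definition connected_matroid :: "'a matroid \<Rightarrow> bool" where
  "connected_matroid M \<longleftrightarrow> matroid M \<and>
    (\<forall>x \<in> ground M. \<forall>y \<in> ground M. x \<noteq> y \<longrightarrow> (\<exists>C \<in> circuits M. x \<in> C \<and> y \<in> C))"

text \<open>Linear independence over GF(2) of the family of vectors
  \<open>(v e 0, \<dots>, v e (n - 1))\<close> indexed by \<open>e \<in> X\<close>, for finite \<open>X\<close>.  Being about families rather
  than sets of vectors, it makes two indices carrying the same vector dependent.\<close>

definition lin_indep_family_GF2 :: "nat \<Rightarrow> ('a \<Rightarrow> nat \<Rightarrow> bit) \<Rightarrow> 'a set \<Rightarrow> bool" where
  "lin_indep_family_GF2 n v X \<longleftrightarrow>
    (\<forall>c :: 'a \<Rightarrow> bit. (\<forall>i<n. (\<Sum>e\<in>X. c e * v e i) = 0) \<longrightarrow> (\<forall>e\<in>X. c e = 0))"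

text \<open>A matroid is binary if it is the vector matroid of a matrix over GF(2); below,
  \<open>v e\<close> is the column of length \<open>n\<close> labelled by \<open>e\<close>.\<close>

definition binary_matroid :: "'a matroid \<Rightarrow> bool" where
  "binary_matroid M \<longleftrightarrow> matroid M \<and>
    (\<exists>n v. \<forall>X \<subseteq> ground M. X \<in> indep M \<longleftrightarrow> lin_indep_family_GF2 n v X)"

definition matroid_hom :: "'a matroid \<Rightarrow> 'b matroid \<Rightarrow> ('a \<Rightarrow> 'b) \<Rightarrow> bool" where
  "matroid_hom M N f \<longleftrightarrow>
    f ` ground M = ground N \<and> (\<forall>C \<in> circuits M. f ` C \<in> circuits N)"

text \<open>A series class here is only required to consist of elements
  that are pairwise in series; it need not be maximal with this property.\<close>

definition series_class :: "'a matroid \<Rightarrow> 'a set \<Rightarrow> bool" where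
  "series_class M S \<longleftrightarrow>
    S \<subseteq> ground M \<and> (\<forall>C \<in> circuits M. C \<inter> S \<noteq> {} \<longrightarrow> S \<subseteq> C)"

end

theory Submission
  imports Defs
begin

text \<open>
  If a fibre of \<open>f\<close> is not a series class, connectedness yields a circuit \<open>A\<close> and an ear \<open>C\<close> of
  \<open>A\<close> such that \<open>f(C - A)\<close> meets \<open>f(A)\<close>. Since \<open>N\<close> is binary, the symmetric difference of
  \<open>f(A)\<close> and \<open>f(C)\<close>, if nonempty, is the image of every third circuit in \<open>A \<union> C\<close>, which would make
  \<open>f(C - A)\<close> and \<open>f(A)\<close> disjoint; hence \<open>f(A)\<close> and \<open>f(C)\<close> are the same circuit \<open>Z\<close>.

  If \<open>Z\<close> is not the whole ground set, attach to \<open>L = A \<union> C\<close> an ear \<open>E\<close> through an element mapped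
  outside \<open>Z\<close>. Two circuits in \<open>L \<union> E\<close> that use the ear have distinct images, as eliminating an
  element of the ear leaves a circuit in \<open>L\<close>, whose image is \<open>Z\<close>; since \<open>N\<close> is binary, the
  symmetric difference of these images is \<open>Z\<close>. Hence at most two circuits use the ear. But \<open>A\<close>
  and \<open>C\<close> are both symmetric differences of two such circuits, so \<open>A = C\<close>, a contradiction.
\<close>

section \<open>Circuits\<close>

lemma circuit_subset_ground: "C \<in> circuits M \<Longrightarrow> C \<subseteq> ground M"
  and circuit_dependent: "C \<in> circuits M \<Longrightarrow> C \<notin> indep M"
  and psubset_circuit_indep: "C \<in> circuits M \<Longrightarrow> D \<subset> C \<Longrightarrow> D \<in> indep M"
  unfolding circuits_def by blast+

lemma dependent_subset_circuit_eq:
  assumes "C \<in> circuits M" "D \<subseteq> C" "D \<notin> indep M"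
  shows "D = C"
  using assms psubset_circuit_indep by blast

lemma circuits_subset_eq:
  assumes "C \<in> circuits M" "D \<in> circuits M" "C \<subseteq> D"
  shows "C = D"
  using assms dependent_subset_circuit_eq circuit_dependent by blast

context matroid
begin

lemma indep_finite: "X \<in> indep M \<Longrightarrow> finite X"
  using indep_subset_ground finite_ground finite_subset by blast

lemma circuit_finite: "C \<in> circuits M \<Longrightarrow> finite C"
  using circuit_subset_ground finite_ground finite_subset by blast

lemma circuit_nonempty: "C \<in> circuits M \<Longrightarrow> C \<noteq> {}"
  using indep_empty circuit_dependent by blast

lemma dependent_contains_circuit:
  assumes "X \<subseteq> ground M" "X \<notin> indep M"
  obtains C where "C \<in> circuits M" "C \<subseteq> X"
proof -
  define dependents where "dependents = {D. D \<subseteq> X \<and> D \<notin> indep M}"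
  have "finite X" using assms(1) finite_ground by (rule finite_subset)
  then have "finite dependents" unfolding dependents_def by simp
  moreover have "X \<in> dependents" using assms(2) unfolding dependents_def by simp
  ultimately obtain C where "C \<in> dependents" and minimal: "\<forall>D \<in> dependents. D \<subseteq> C \<longrightarrow> C = D"
    using finite_has_minimal2[of dependents X] by blast
  then have C: "C \<subseteq> X" "C \<notin> indep M" unfolding dependents_def by simp_all
  then have "D \<in> indep M" if "D \<subset> C" for D
    using minimal that unfolding dependents_def by blast
  then have "C \<in> circuits M" using C assms(1) unfolding circuits_def by simp
  then show thesis using that C(1) by blast
qed

lemma indep_extend:
  assumes "X \<in> indep M" "Y \<in> indep M" "card X \<le> card Y"
  obtains I where "I \<in> indep M" "X \<subseteq> I" "I \<subseteq> X \<union> Y" "card I = card Y"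
  using assms
proof (induction "card Y - card X" arbitrary: X thesis)
  case 0
  then show ?case by auto
next
  case (Suc n)
  then obtain y where y: "y \<in> Y - X" "insert y X \<in> indep M"
    using indep_augment[of X Y] by (metis zero_less_Suc zero_less_diff)
  then have "card (insert y X) = Suc (card X)" using Suc.prems(2) indep_finite by simp
  then have "n = card Y - card (insert y X)" "card (insert y X) \<le> card Y"
    using Suc.hyps(2) by simp_all
  then obtain I where "I \<in> indep M" "insert y X \<subseteq> I" "I \<subseteq> insert y X \<union> Y" "card I = card Y"
    using Suc.hyps(1) y(2) Suc.prems(3) by blast
  then show ?case using Suc.prems(1) y(1) by blast
qed

lemma circuit_elimination:
  assumes C1: "C1 \<in> circuits M" and C2: "C2 \<in> circuits M" and "C1 \<noteq> C2"
    and e: "e \<in> C1" "e \<in> C2"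
  obtains C where "C \<in> circuits M" "C \<subseteq> C1 \<union> C2 - {e}"
proof -
  have "C1 \<union> C2 - {e} \<notin> indep M"
  proof
    assume indep: "C1 \<union> C2 - {e} \<in> indep M"
    have fin: "finite (C1 \<union> C2)" using C1 C2 circuit_finite by blast
    obtain x where x: "x \<in> C2" "x \<notin> C1" using circuits_subset_eq C1 C2 \<open>C1 \<noteq> C2\<close> by blast
    have "C2 - {x} \<in> indep M" using psubset_circuit_indep[OF C2] x(1) by blast
    moreover have "card (C2 - {x}) \<le> card (C1 \<union> C2 - {e})"
      using x(1) e fin card_mono[OF fin, of C2] by (simp add: card_Diff_singleton diff_le_mono)
    ultimately obtain I where I: "I \<in> indep M" "C2 - {x} \<subseteq> I"
      "I \<subseteq> (C2 - {x}) \<union> (C1 \<union> C2 - {e})" and card_I: "card I = card (C1 \<union> C2 - {e})"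
      using indep_extend[OF _ indep] by metis
    have "x \<notin> I" using I(1,2) circuit_dependent[OF C2] indep_subset by blast
    then have "I \<subseteq> C1 \<union> C2 - {x}" using I(3) by blast
    moreover have "card I = card (C1 \<union> C2 - {x})" using card_I x(1) e fin by simp
    ultimately have "I = C1 \<union> C2 - {x}" using card_subset_eq[OF finite_Diff[OF fin]] by blast
    then have "C1 \<subseteq> I" using x(2) by blast
    then show False using I(1) circuit_dependent[OF C1] indep_subset by blast
  qed
  moreover have "C1 \<union> C2 - {e} \<subseteq> ground M"
    using circuit_subset_ground C1 C2 by blast
  ultimately show thesis using dependent_contains_circuit that by metis
qed

lemma strong_circuit_elimination:
  assumes "C1 \<in> circuits M" "C2 \<in> circuits M" "e \<in> C1" "e \<in> C2" "y \<in> C1" "y \<notin> C2"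
  shows "\<exists>C \<in> circuits M. y \<in> C \<and> C \<subseteq> C1 \<union> C2 - {e}"
  using assms
proof (induction "card (C1 \<union> C2)" arbitrary: C1 C2 e y rule: less_induct)
  case less
  note C1 = less.prems(1) and C2 = less.prems(2) and e = less.prems(3,4) and y = less.prems(5,6)
  have fin: "finite (C1 \<union> C2)" using C1 C2 circuit_finite by blast
  obtain C3 where C3: "C3 \<in> circuits M" "C3 \<subseteq> C1 \<union> C2 - {e}"
    using circuit_elimination[OF C1 C2 _ e] y by blast
  show ?case
  proof (cases "y \<in> C3")
    case True
    then show ?thesis using C3 by blast
  next
    case False
    obtain g where g: "g \<in> C3" "g \<notin> C1" "g \<in> C2"
      using circuits_subset_eq[OF C3(1) C1] C3 e(1) by blast
    have "C2 \<union> C3 \<subset> C1 \<union> C2" using C3(2) False y by blast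
    then have "card (C2 \<union> C3) < card (C1 \<union> C2)" by (rule psubset_card_mono[OF fin])
    then obtain C4 where C4: "C4 \<in> circuits M" "e \<in> C4" "C4 \<subseteq> C2 \<union> C3 - {g}"
      using less.hyps[OF _ C2 C3(1) g(3,1) e(2)] C3(2) by blast
    have "C1 \<union> C4 \<subset> C1 \<union> C2" using C4(3) C3(2) g by blast
    then have "card (C1 \<union> C4) < card (C1 \<union> C2)" by (rule psubset_card_mono[OF fin])
    moreover have "y \<notin> C4" using C4(3) False y(2) by blast
    ultimately obtain C5 where "C5 \<in> circuits M" "y \<in> C5" "C5 \<subseteq> C1 \<union> C4 - {e}"
      using less.hyps[OF _ C1 C4(1) e(1) C4(2) y(1)] by blast
    then show ?thesis using C4(3) C3(2) by blast
  qed
qed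

end

section \<open>Ears\<close>

definition crossing_circuits :: "'a matroid \<Rightarrow> 'a set \<Rightarrow> 'a set \<Rightarrow> 'a set set" where
  "crossing_circuits M X Y = {C \<in> circuits M. C \<subseteq> X \<union> Y \<and> \<not> C \<subseteq> X}"

text \<open>The last condition says that \<open>E - X\<close> is a circuit of the contraction \<open>M/X\<close>.\<close>

definition ear :: "'a matroid \<Rightarrow> 'a set \<Rightarrow> 'a set \<Rightarrow> bool" where
  "ear M X E \<longleftrightarrow> E \<in> crossing_circuits M X E \<and> E \<inter> X \<noteq> {} \<and>
    (\<forall>C \<in> crossing_circuits M X E. E - X \<subseteq> C)"

lemma crossing_circuits_circuit: "C \<in> crossing_circuits M X Y \<Longrightarrow> C \<in> circuits M"
  unfolding crossing_circuits_def by blast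

lemma ear_circuit: "ear M X E \<Longrightarrow> E \<in> circuits M"
  unfolding ear_def crossing_circuits_def by blast

lemma ear_subset_crossing: "ear M X E \<Longrightarrow> C \<in> crossing_circuits M X E \<Longrightarrow> E - X \<subseteq> C"
  unfolding ear_def by blast

lemma ear_of_circuit_subset:
  assumes "A \<in> circuits M" "ear M A E" "C \<in> circuits M" "C \<subseteq> A \<union> E" "C \<noteq> A"
  shows "E - A \<subseteq> C"
  using assms circuits_subset_eq[of C M A] ear_subset_crossing
  unfolding crossing_circuits_def by blast

context matroid
begin

lemma ear_exists:
  assumes B: "B \<in> circuits M" "B \<inter> X \<noteq> {}" and y: "y \<in> B" "y \<notin> X"
  obtains E where "ear M X E" "y \<in> E" "E \<subseteq> X \<union> B"
proof -
  let ?candidate = "\<lambda>C. C \<in> circuits M \<and> y \<in> C \<and> C \<subseteq> X \<union> B"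
  obtain E where E: "?candidate E"
    and least: "\<And>C. ?candidate C \<Longrightarrow> card (E - X) \<le> card (C - X)"
    using ex_has_least_nat[of ?candidate B "\<lambda>C. card (C - X)"] B(1) y(1) by blast
  have minimal: "C - X = E - X" if "?candidate C" "C \<subseteq> X \<union> E" for C
  proof (rule card_seteq)
    show "finite (E - X)" using E circuit_finite by blast
  qed (use that least in auto)
  have meets: "E \<inter> X \<noteq> {}" using E B circuits_subset_eq[of E M B] by blast
  have "E - X \<subseteq> C" if crossing: "C \<in> crossing_circuits M X E" for C
  proof (cases "y \<in> C")
    case True
    then show ?thesis using minimal[of C] crossing E unfolding crossing_circuits_def by blast
  next
    case False
    have C: "C \<in> circuits M" "C \<subseteq> X \<union> E" using crossing unfolding crossing_circuits_def by blast+
    obtain w where w: "w \<in> C" "w \<in> E" "w \<notin> X"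
      using crossing unfolding crossing_circuits_def by blast
    then obtain C' where "C' \<in> circuits M" "y \<in> C'" "C' \<subseteq> E \<union> C - {w}"
      using strong_circuit_elimination[of E C w y] E C(1) False by blast
    then have "C' - X = E - X" "w \<notin> C'" using minimal[of C'] E C(2) by blast+
    then show ?thesis using w by blast
  qed
  then have "ear M X E"
    using E y(2) meets unfolding ear_def crossing_circuits_def by blast
  then show thesis using that E by blast
qed

lemma connected_ear_exists:
  assumes "connected_matroid M" "X \<subseteq> ground M" "X \<noteq> {}" "y \<in> ground M" "y \<notin> X"
  obtains E where "ear M X E" "y \<in> E"
proof -
  obtain x where x: "x \<in> X" using assms(3) by blast
  then have "x \<in> ground M" "x \<noteq> y" using assms(2,5) by blast+
  then obtain B where "B \<in> circuits M" "x \<in> B" "y \<in> B"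
    using assms(1,4) unfolding connected_matroid_def by blast
  then show thesis using ear_exists[of B X y] x assms(5) that by blast
qed

lemma sym_diff_ear_subset_circuit:
  assumes A: "A \<in> circuits M" and ear: "ear M A E"
    and C: "C \<in> circuits M" "C \<subseteq> A \<union> E" "C \<noteq> A" "C \<noteq> E"
  shows "sym_diff A E \<subseteq> C"
proof -
  have E_sub: "E - A \<subseteq> C" using ear_of_circuit_subset[OF A ear C(1,2,3)] .
  obtain d where d: "d \<in> E" "d \<notin> A"
    using ear unfolding ear_def crossing_circuits_def by blast
  then obtain K where K: "K \<in> circuits M" "K \<subseteq> C \<union> E - {d}"
    using circuit_elimination[OF C(1) ear_circuit[OF ear] C(4)] E_sub by blast
  then have "K = A" using ear_of_circuit_subset[OF A ear K(1)] C(2) d by blast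
  then show ?thesis using K(2) E_sub by blast
qed

end

section \<open>Binary matroids\<close>

lemma sum_sym_diff_bit:
  fixes g :: "'a \<Rightarrow> bit"
  assumes "finite X" "finite Y"
  shows "sum g (sym_diff X Y) = sum g X + sum g Y"
proof -
  have "sum g X + sum g Y = sum g (X \<union> Y) + sum g (X \<inter> Y)"
    using sum.union_inter[OF assms, of g] by (rule sym)
  also have "sum g (X \<union> Y) = sum g (X - Y) + sum g (Y - X) + sum g (X \<inter> Y)"
    by (rule sum.union_diff2[OF assms])
  also have "sum g (X - Y) + sum g (Y - X) = sum g (sym_diff X Y)"
    using assms by (intro sum.union_disjoint[symmetric]) auto
  also have "sum g (sym_diff X Y) + sum g (X \<inter> Y) + sum g (X \<inter> Y) = sum g (sym_diff X Y)"
    by (cases "sum g (X \<inter> Y)") (simp_all add: add.assoc del: add_bit_eq_xor)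
  finally show ?thesis by (rule sym)
qed

lemma lin_indep_family_GF2_iff:
  assumes "finite X"
  shows "lin_indep_family_GF2 n v X \<longleftrightarrow>
    (\<forall>S \<subseteq> X. (\<forall>i<n. (\<Sum>e\<in>S. v e i) = 0) \<longrightarrow> S = {})"
proof -
  have combination: "(\<Sum>e\<in>X. c e * v e i) = (\<Sum>e | e \<in> X \<and> c e = 1. v e i)" for c i
    using assms by (intro sum.mono_neutral_cong_right) auto
  show ?thesis
  proof
    assume indep: "lin_indep_family_GF2 n v X"
    show "\<forall>S \<subseteq> X. (\<forall>i<n. (\<Sum>e\<in>S. v e i) = 0) \<longrightarrow> S = {}"
    proof (intro allI impI)
      fix S assume S: "S \<subseteq> X" "\<forall>i<n. (\<Sum>e\<in>S. v e i) = 0"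
      let ?c = "\<lambda>e. if e \<in> S then 1 else 0 :: bit"
      have "{e \<in> X. ?c e = 1} = S" using S(1) by auto
      then have "\<forall>i<n. (\<Sum>e\<in>X. ?c e * v e i) = 0"
        using S(2) unfolding combination by simp
      then have "\<forall>e\<in>X. ?c e = 0"
        by (rule indep[unfolded lin_indep_family_GF2_def, THEN spec, THEN mp])
      then have "e \<notin> S" if "e \<in> X" for e using that by (metis zero_neq_one)
      then show "S = {}" using S(1) by blast
    qed
  next
    assume no_zero_sum: "\<forall>S \<subseteq> X. (\<forall>i<n. (\<Sum>e\<in>S. v e i) = 0) \<longrightarrow> S = {}"
    show "lin_indep_family_GF2 n v X"
      unfolding lin_indep_family_GF2_def
    proof (intro allI impI)
      fix c :: "'a \<Rightarrow> bit" assume "\<forall>i<n. (\<Sum>e\<in>X. c e * v e i) = 0"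
      then have "\<forall>i<n. (\<Sum>e | e \<in> X \<and> c e = 1. v e i) = 0" unfolding combination .
      then have "{e \<in> X. c e = 1} = {}"
        by (intro no_zero_sum[THEN spec, THEN mp, THEN mp] Collect_restrict)
      then show "\<forall>e\<in>X. c e = 0" by auto
    qed
  qed
qed

definition represents_GF2 :: "nat \<Rightarrow> ('a \<Rightarrow> nat \<Rightarrow> bit) \<Rightarrow> 'a matroid \<Rightarrow> bool" where
  "represents_GF2 n v M \<longleftrightarrow> (\<forall>X \<subseteq> ground M. X \<in> indep M \<longleftrightarrow> lin_indep_family_GF2 n v X)"

context matroid
begin

lemma represents_GF2_indep_iff:
  assumes "represents_GF2 n v M" "X \<subseteq> ground M"
  shows "X \<in> indep M \<longleftrightarrow> (\<forall>S \<subseteq> X. (\<forall>i<n. (\<Sum>e\<in>S. v e i) = 0) \<longrightarrow> S = {})"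
proof -
  have "X \<in> indep M \<longleftrightarrow> lin_indep_family_GF2 n v X"
    using assms unfolding represents_GF2_def by blast
  also have "\<dots> \<longleftrightarrow> (\<forall>S \<subseteq> X. (\<forall>i<n. (\<Sum>e\<in>S. v e i) = 0) \<longrightarrow> S = {})"
    using finite_subset[OF assms(2) finite_ground] by (rule lin_indep_family_GF2_iff)
  finally show ?thesis .
qed

lemma represents_GF2_circuit_sum:
  assumes rep: "represents_GF2 n v M" and C: "C \<in> circuits M" and "i < n"
  shows "(\<Sum>e\<in>C. v e i) = 0"
proof -
  have C_ground: "C \<subseteq> ground M" using circuit_subset_ground[OF C] .
  obtain S where S: "S \<subseteq> C" "\<forall>i<n. (\<Sum>e\<in>S. v e i) = 0" "S \<noteq> {}"
    using represents_GF2_indep_iff[OF rep C_ground] circuit_dependent[OF C] by blast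
  then have "S \<notin> indep M" using represents_GF2_indep_iff[OF rep, of S] C_ground by blast
  then have "S = C" using dependent_subset_circuit_eq[OF C S(1)] by blast
  then show ?thesis using S(2) \<open>i < n\<close> by blast
qed

end

lemma binary_sym_diff_dependent:
  assumes "binary_matroid N" and C: "C1 \<in> circuits N" "C2 \<in> circuits N" "C1 \<noteq> C2"
  shows "sym_diff C1 C2 \<notin> indep N"
proof -
  interpret matroid N using assms(1) unfolding binary_matroid_def by blast
  obtain n v where rep: "represents_GF2 n v N"
    using assms(1) unfolding binary_matroid_def represents_GF2_def by blast
  have "\<forall>i<n. (\<Sum>e\<in>sym_diff C1 C2. v e i) = 0"
    using sum_sym_diff_bit[OF circuit_finite[OF C(1)] circuit_finite[OF C(2)]]
      represents_GF2_circuit_sum[OF rep] C(1,2) by simp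
  moreover have "sym_diff C1 C2 \<noteq> {}" using C(3) by blast
  moreover have "sym_diff C1 C2 \<subseteq> ground N" using circuit_subset_ground C(1,2) by blast
  ultimately show ?thesis using represents_GF2_indep_iff[OF rep] by blast
qed

lemma binary_sym_diff_eq_circuit:
  assumes "binary_matroid N" "C1 \<in> circuits N" "C2 \<in> circuits N" "C1 \<noteq> C2"
    and "C \<in> circuits N" "sym_diff C1 C2 \<subseteq> C"
  shows "sym_diff C1 C2 = C"
  using assms binary_sym_diff_dependent dependent_subset_circuit_eq by metis

section \<open>Homomorphisms to binary matroids\<close>

locale binary_hom = matroid M for M :: "'a matroid" +
  fixes N :: "'b matroid" and f :: "'a \<Rightarrow> 'b"
  assumes binary: "binary_matroid N"
    and hom: "matroid_hom M N f"
begin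

lemma image_ground: "f ` ground M = ground N"
  and image_circuit: "C \<in> circuits M \<Longrightarrow> f ` C \<in> circuits N"
  using hom unfolding matroid_hom_def by blast+

lemma
  assumes A: "A \<in> circuits M" and ear: "ear M A E" and ne: "f ` E \<noteq> f ` A"
  shows sym_diff_ear_circuit: "sym_diff A E \<in> circuits M"
    and ear_image_disjoint: "f ` (E - A) \<inter> f ` A = {}"
proof -
  obtain e where e: "e \<in> A" "e \<in> E" using ear unfolding ear_def by blast
  obtain K where K: "K \<in> circuits M" "K \<subseteq> A \<union> E - {e}"
    using circuit_elimination[OF A ear_circuit[OF ear] _ e] ne by blast
  have sub: "sym_diff A E \<subseteq> K"
    using sym_diff_ear_subset_circuit[OF A ear K(1)] K(2) e by blast
  have "sym_diff (f ` A) (f ` E) \<subseteq> f ` K" using sub by blast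
  then have image_K: "sym_diff (f ` A) (f ` E) = f ` K"
    using binary_sym_diff_eq_circuit[OF binary] ne
      image_circuit[OF A] image_circuit[OF ear_circuit[OF ear]] image_circuit[OF K(1)]
    by simp
  have image_notin: "f u \<notin> f ` A \<inter> f ` E" if "u \<in> K" for u
    using imageI[OF that, of f] unfolding image_K[symmetric] by blast
  then have "K \<inter> (A \<inter> E) = {}" by blast
  then have "K = sym_diff A E" using sub K(2) by blast
  then show "sym_diff A E \<in> circuits M" using K(1) by simp
  show "f ` (E - A) \<inter> f ` A = {}" using sub image_notin by blast
qed

context
  fixes L E :: "'a set" and Z :: "'b set" and y :: 'a
  assumes ear: "ear M L E"
    and Z: "Z \<in> circuits N"
    and image_base: "f ` L \<subseteq> Z"
    and y: "y \<in> E" "f y \<notin> Z"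
begin

lemma mem_crossing_circuit: "K \<in> crossing_circuits M L E \<Longrightarrow> y \<in> K"
  using ear_subset_crossing[OF ear] image_base y by blast

lemma crossing_image_inj: "inj_on (image f) (crossing_circuits M L E)"
proof (rule inj_onI, rule ccontr)
  fix K1 K2
  assume K: "K1 \<in> crossing_circuits M L E" "K2 \<in> crossing_circuits M L E"
    and image_eq: "f ` K1 = f ` K2" and "K1 \<noteq> K2"
  have "y \<in> K1" "y \<in> K2" using K by (simp_all add: mem_crossing_circuit)
  then obtain C where C: "C \<in> circuits M" "C \<subseteq> K1 \<union> K2 - {y}"
    using circuit_elimination[OF _ _ \<open>K1 \<noteq> K2\<close>] K crossing_circuits_circuit by metis
  then have "C \<subseteq> L \<union> E" "y \<notin> C" using K unfolding crossing_circuits_def by blast+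
  then have "C \<subseteq> L"
    using mem_crossing_circuit[of C] C(1) unfolding crossing_circuits_def by blast
  then have "f ` C = Z"
    using circuits_subset_eq[OF image_circuit[OF C(1)] Z] image_base by blast
  then have "Z \<subseteq> f ` K1" using C(2) image_eq by blast
  then have "Z = f ` K1"
    using circuits_subset_eq[OF Z] image_circuit K(1) crossing_circuits_circuit by blast
  then show False using \<open>y \<in> K1\<close> y(2) by blast
qed

lemma crossing_image_sym_diff:
  assumes K: "K1 \<in> crossing_circuits M L E" "K2 \<in> crossing_circuits M L E" "K1 \<noteq> K2"
  shows "sym_diff (f ` K1) (f ` K2) = Z"
proof (rule binary_sym_diff_eq_circuit[OF binary])
  show "f ` K1 \<in> circuits N" "f ` K2 \<in> circuits N"
    using K image_circuit crossing_circuits_circuit by blast+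
  show "f ` K1 \<noteq> f ` K2" using crossing_image_inj K by (meson inj_onD)
  have "K1 \<subseteq> L \<union> K2" "K2 \<subseteq> L \<union> K1"
    using K ear_subset_crossing[OF ear] unfolding crossing_circuits_def by blast+
  then show "sym_diff (f ` K1) (f ` K2) \<subseteq> Z" using image_base by blast
qed (rule Z)

lemma crossing_circuits_eq_doubleton:
  assumes "K1 \<in> crossing_circuits M L E" "K2 \<in> crossing_circuits M L E" "K1 \<noteq> K2"
  shows "crossing_circuits M L E = {K1, K2}"
proof -
  have "K = K1 \<or> K = K2" if K: "K \<in> crossing_circuits M L E" for K
  proof (rule ccontr)
    assume "\<not> ?thesis"
    then have "sym_diff (f ` K) (f ` K1) = Z" "sym_diff (f ` K) (f ` K2) = Z"
      using crossing_image_sym_diff[OF K assms(1)] crossing_image_sym_diff[OF K assms(2)]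
      by simp_all
    then have "f ` K1 = f ` K2" by blast
    then show False using inj_onD[OF crossing_image_inj] assms by blast
  qed
  then show ?thesis using assms(1,2) by blast
qed

lemma circuit_eq_sym_diff_crossing:
  assumes G: "G \<in> circuits M" "G \<subseteq> L" and K: "K \<in> crossing_circuits M L E" "K \<inter> G \<noteq> {}"
  obtains K1 K2 where "crossing_circuits M L E = {K1, K2}" "G = sym_diff K1 K2"
proof -
  have y_notin: "y \<notin> L" "y \<notin> G" using image_base y(2) G(2) by blast+
  then obtain C where C: "ear M G C" "y \<in> C" "C \<subseteq> G \<union> K"
    using ear_exists[OF crossing_circuits_circuit[OF K(1)] K(2) mem_crossing_circuit[OF K(1)]]
    by metis
  have "f ` C \<noteq> f ` G" using C(2) y(2) image_base G(2) by blast
  then have "sym_diff G C \<in> circuits M" by (rule sym_diff_ear_circuit[OF G(1) C(1)])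
  then have "C \<in> crossing_circuits M L E" "sym_diff G C \<in> crossing_circuits M L E"
    using ear_circuit[OF C(1)] C(2,3) K(1) G(2) y_notin(1)
    unfolding crossing_circuits_def by blast+
  moreover have "C \<noteq> sym_diff G C" using circuit_nonempty[OF G(1)] by blast
  ultimately have "crossing_circuits M L E = {C, sym_diff G C}"
    by (rule crossing_circuits_eq_doubleton)
  moreover have "G = sym_diff C (sym_diff G C)" by blast
  ultimately show thesis by (rule that)
qed

lemma intersecting_circuits_eq:
  assumes G: "G \<in> circuits M" "G \<subseteq> L" and H: "H \<in> circuits M" "H \<subseteq> L"
    and "G \<inter> H \<noteq> {}" and K: "K \<in> crossing_circuits M L E" "K \<inter> G \<noteq> {}"
  shows "G = H"
proof -
  obtain K1 K2 where split_G: "crossing_circuits M L E = {K1, K2}" "G = sym_diff K1 K2"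
    by (rule circuit_eq_sym_diff_crossing[OF G K])
  then have "K1 \<in> crossing_circuits M L E" "K2 \<in> crossing_circuits M L E" by simp_all
  moreover have "K1 \<inter> H \<noteq> {} \<or> K2 \<inter> H \<noteq> {}" using split_G(2) \<open>G \<inter> H \<noteq> {}\<close> by blast
  ultimately obtain K3 K4 where split_H: "crossing_circuits M L E = {K3, K4}" "H = sym_diff K3 K4"
    using circuit_eq_sym_diff_crossing[OF H] by metis
  have "{K1, K2} = {K3, K4}" using split_G(1) split_H(1) by simp
  then show ?thesis
    unfolding split_G(2) split_H(2) doubleton_eq_iff by (auto simp: Un_commute)
qed

end

lemma ear_image_eq_imp_image_eq_ground:
  assumes "connected_matroid M" and A: "A \<in> circuits M" and C: "ear M A C"
    and image_eq: "f ` C = f ` A"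
  shows "f ` A = ground N"
proof (rule ccontr)
  assume "f ` A \<noteq> ground N"
  then have "f ` A \<noteq> f ` ground M" using image_ground by simp
  then obtain y where y: "y \<in> ground M" "f y \<notin> f ` A"
    using image_mono[OF circuit_subset_ground[OF A], of f] by blast
  have image_union: "f ` (A \<union> C) \<subseteq> f ` A" using image_eq by blast
  have "A \<union> C \<subseteq> ground M" "A \<union> C \<noteq> {}" "y \<notin> A \<union> C"
    using circuit_subset_ground A ear_circuit[OF C] circuit_nonempty[OF A] image_union y(2)
    by blast+
  then obtain E where E: "ear M (A \<union> C) E" "y \<in> E"
    using y(1) connected_ear_exists[OF assms(1), of "A \<union> C" y] by metis
  note circuits_eqI = intersecting_circuits_eq[OF E(1) image_circuit[OF A] image_union E(2) y(2)]
  have crossing: "E \<in> crossing_circuits M (A \<union> C) E" using E(1) unfolding ear_def by blast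
  have circuits_meet: "A \<inter> C \<noteq> {}" "C \<inter> A \<noteq> {}" using C unfolding ear_def by blast+
  consider (meets_A) "E \<inter> A \<noteq> {}" | (meets_C) "E \<inter> C \<noteq> {}"
    using E(1) unfolding ear_def by blast
  then have "A = C"
  proof cases
    case meets_A
    show ?thesis
      using circuits_eqI[OF A _ ear_circuit[OF C] _ circuits_meet(1) crossing meets_A] by simp
  next
    case meets_C
    show ?thesis
      using circuits_eqI[OF ear_circuit[OF C] _ A _ circuits_meet(2) crossing meets_C] by simp
  qed
  then show False using C unfolding ear_def crossing_circuits_def by blast
qed

end

theorem theorem1:
  fixes M :: "'a matroid" and N :: "'b matroid" and f :: "'a \<Rightarrow> 'b"
  assumes "connected_matroid M"
    and "binary_matroid N"
    and "matroid_hom M N f"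
  shows "(\<forall>x \<in> ground N. series_class M (f -` {x} \<inter> ground M)) \<or> ground N \<in> circuits N"
proof (cases "\<forall>x \<in> ground N. series_class M (f -` {x} \<inter> ground M)")
  case False
  interpret matroid M using assms(1) unfolding connected_matroid_def by blast
  interpret binary_hom M N f using assms(2,3) by unfold_locales
  obtain A x1 x2 where A: "A \<in> circuits M"
    and x: "x1 \<in> A" "x2 \<in> ground M" "x2 \<notin> A" "f x1 = f x2"
    using False unfolding series_class_def by fastforce
  obtain C where C: "ear M A C" "x2 \<in> C"
    using connected_ear_exists[OF assms(1) circuit_subset_ground[OF A] circuit_nonempty[OF A]] x
    by blast
  have "f x2 \<in> f ` (C - A)" using C(2) x(3) by blast
  moreover have "f x2 \<in> f ` A" using x(1) unfolding x(4)[symmetric] by (rule imageI)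
  ultimately have "f ` C = f ` A" using ear_image_disjoint[OF A C(1)] by blast
  then have "f ` A = ground N"
    by (rule ear_image_eq_imp_image_eq_ground[OF assms(1) A C(1)])
  then show ?thesis using image_circuit[OF A] by simp
qed simp

end
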